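(* Every set function $f$ can be decomposed as $$f=\iota_f\circ (f/E_f)\circ p_f .$$
   Context: Let $f$ be a set function with domain $\mathrm{Dom}\,f$, range (codomain) $\mathrm{Range}\,f$ and image $\mathrm{Im}\,f$. $E_f$ is the equivalence relation on $\mathrm{Dom}\,f$ with $x\,E_f\,y$ iff $f(x)=f(y)$; its classes are the nonempty fibers $f^{-1}[z]$, $z\in\mathrm{Im}\,f$. $\mathrm{Dom}\,f/E_f$ is the set of these fibers. $p_f:\mathrm{Dom}\,f\to\mathrm{Dom}\,f/E_f$ sends an object to the fiber containing it; $f/E_f:\mathrm{Dom}\,f/E_f\to\mathrm{Im}\,f$ sends $f^{-1}[z]$ to $z$; and $\iota_f:\mathrm{Im}\,f\to\mathrm{Range}\,f$ is the inclusion. *)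

theory Defs
  imports Main "HOL-Library.FuncSet"
begin

text \<open>A set function carries its domain and codomain, so that equality of set functions compares
  both in addition to the values. The mapping is kept extensional (\<^term>\<open>undefined\<close> off the domain),
  so equality of records does not depend on junk values.\<close>

record ('a, 'b) set_fun =
  Dom :: "'a set"
  Cod :: "'b set"
  app :: "'a \<Rightarrow> 'b"

definition is_set_fun :: "('a, 'b) set_fun \<Rightarrow> bool" where
  "is_set_fun f \<longleftrightarrow> app f \<in> Dom f \<rightarrow>\<^sub>E Cod f"

definition Img :: "('a, 'b) set_fun \<Rightarrow> 'b set" where
  "Img f = app f ` Dom f"

definition fiber :: "('a, 'b) set_fun \<Rightarrow> 'b \<Rightarrow> 'a set" where
  "fiber f z = {x \<in> Dom f. app f x = z}"

definition fiber_rel :: "('a, 'b) set_fun \<Rightarrow> ('a \<times> 'a) set" where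
  "fiber_rel f = {(x, y). x \<in> Dom f \<and> y \<in> Dom f \<and> app f x = app f y}"

text \<open>Composition is meaningful only under \<open>composable\<close>; outside it \<open>comp_fun\<close> returns a junk record.\<close>

definition composable :: "('b, 'c) set_fun \<Rightarrow> ('a, 'b) set_fun \<Rightarrow> bool" where
  "composable g f \<longleftrightarrow> is_set_fun g \<and> is_set_fun f \<and> Cod f = Dom g"

definition comp_fun :: "('b, 'c) set_fun \<Rightarrow> ('a, 'b) set_fun \<Rightarrow> ('a, 'c) set_fun"
    (infixr "\<circ>\<^sub>S" 55) where
  "g \<circ>\<^sub>S f = \<lparr>Dom = Dom f, Cod = Cod g, app = compose (Dom f) (app g) (app f)\<rparr>"

definition proj_fun :: "('a, 'b) set_fun \<Rightarrow> ('a, 'a set) set_fun" where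
  "proj_fun f = \<lparr>Dom = Dom f, Cod = Dom f // fiber_rel f,
     app = (\<lambda>x\<in>Dom f. THE C. C \<in> Dom f // fiber_rel f \<and> x \<in> C)\<rparr>"

definition quot_fun :: "('a, 'b) set_fun \<Rightarrow> ('a set, 'b) set_fun" where
  "quot_fun f = \<lparr>Dom = Dom f // fiber_rel f, Cod = Img f,
     app = (\<lambda>C\<in>Dom f // fiber_rel f. THE z. z \<in> Img f \<and> C = fiber f z)\<rparr>"

definition incl_fun :: "('a, 'b) set_fun \<Rightarrow> ('b, 'b) set_fun" where
  "incl_fun f = \<lparr>Dom = Img f, Cod = Cod f, app = (\<lambda>z\<in>Img f. z)\<rparr>"

lemma equiv_fiber_rel: "equiv (Dom f) (fiber_rel f)"
  by (auto simp: equiv_def refl_on_def sym_def trans_def fiber_rel_def)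

lemma fiber_rel_classes: "Dom f // fiber_rel f = fiber f ` Img f"
proof -
  have "fiber_rel f `` {x} = fiber f (app f x)" if "x \<in> Dom f" for x
    using that by (auto simp: fiber_rel_def fiber_def)
  then show ?thesis
    by (auto simp: quotient_def Img_def)
qed

end

theory Submission
  imports Defs
begin

text \<open>On the domain of \<open>f\<close> the projection sends \<open>x\<close> to \<open>fiber f (app f x)\<close>, because the fibers
  partition the domain and this is the one that contains \<open>x\<close>. A fiber over a point \<open>z\<close> of the image
  is nonempty, so it determines \<open>z\<close>, and the quotient map sends it back to \<open>z\<close>. The three maps
  therefore act by \<open>x \<mapsto> fiber f (app f x) \<mapsto> app f x \<mapsto> app f x\<close>. Since both \<open>f\<close> and the composite are
  \<open>undefined\<close> off the domain and end in the same codomain, this agreement of values is equality of set functions.\<close>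

lemma proj_fun_apply:
  assumes "x \<in> Dom f"
  shows "app (proj_fun f) x = fiber f (app f x)"
proof -
  have "(THE C. C \<in> Dom f // fiber_rel f \<and> x \<in> C) = fiber f (app f x)"
    using assms by (intro the_equality) (auto simp: fiber_rel_classes fiber_def Img_def)
  then show ?thesis
    using assms by (simp add: proj_fun_def)
qed

text \<open>A point of the image is recovered as the value of \<open>f\<close> at any element of its nonempty fiber,
  whereas all points outside the image share the empty fiber.\<close>

lemma inj_on_fiber: "inj_on (fiber f) (Img f)"
  by (auto simp: inj_on_def fiber_def Img_def)

lemma quot_fun_fiber:
  assumes "z \<in> Img f"
  shows "app (quot_fun f) (fiber f z) = z"
proof -
  have "(THE w. w \<in> Img f \<and> fiber f z = fiber f w) = z"
    using assms by (intro the_equality) (auto dest: inj_onD[OF inj_on_fiber])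
  then show ?thesis
    using assms by (simp add: quot_fun_def fiber_rel_classes)
qed

lemma is_set_fun_proj_fun: "is_set_fun (proj_fun f)"
  unfolding is_set_fun_def
proof (rule PiE_I)
  fix x assume "x \<in> Dom (proj_fun f)"
  then have "x \<in> Dom f" by (simp add: proj_fun_def)
  then show "app (proj_fun f) x \<in> Cod (proj_fun f)"
    by (simp add: proj_fun_apply) (simp add: proj_fun_def fiber_rel_classes Img_def)
qed (simp add: proj_fun_def)

lemma is_set_fun_quot_fun: "is_set_fun (quot_fun f)"
  unfolding is_set_fun_def
proof (rule PiE_I)
  fix C assume "C \<in> Dom (quot_fun f)"
  then obtain z where "z \<in> Img f" "C = fiber f z"
    by (auto simp: quot_fun_def fiber_rel_classes)
  then show "app (quot_fun f) C \<in> Cod (quot_fun f)"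
    by (simp add: quot_fun_fiber) (simp add: quot_fun_def)
qed (simp add: quot_fun_def)

lemma is_set_fun_incl_fun:
  assumes "is_set_fun f"
  shows "is_set_fun (incl_fun f)"
  using assms by (auto simp: is_set_fun_def incl_fun_def Img_def)

theorem theorem10p4:
  fixes f :: "('a, 'b) set_fun"
  assumes "is_set_fun f"
  shows "composable (quot_fun f) (proj_fun f)
    \<and> composable (incl_fun f) (quot_fun f)
    \<and> f = incl_fun f \<circ>\<^sub>S quot_fun f \<circ>\<^sub>S proj_fun f"
proof (intro conjI)
  show "composable (quot_fun f) (proj_fun f)"
    by (simp add: composable_def is_set_fun_quot_fun is_set_fun_proj_fun)
      (simp add: quot_fun_def proj_fun_def)
  show "composable (incl_fun f) (quot_fun f)"
    by (simp add: composable_def is_set_fun_incl_fun[OF assms] is_set_fun_quot_fun)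
      (simp add: quot_fun_def incl_fun_def)
  let ?g = "incl_fun f \<circ>\<^sub>S quot_fun f \<circ>\<^sub>S proj_fun f"
  have Dom: "Dom ?g = Dom f" and Cod: "Cod ?g = Cod f"
    by (simp_all add: comp_fun_def proj_fun_def incl_fun_def)
  have "app f x = app ?g x" for x
  proof (cases "x \<in> Dom f")
    case True
    then have z: "app f x \<in> Img f" by (simp add: Img_def)
    have "app ?g x = app (incl_fun f) (app (quot_fun f) (app (proj_fun f) x))"
      using True by (simp add: comp_fun_def compose_def proj_fun_def)
    also have "\<dots> = app f x"
      using True z by (simp add: proj_fun_apply quot_fun_fiber) (simp add: incl_fun_def)
    finally show ?thesis ..
  next
    case False
    then show ?thesis
      using assms by (auto simp: is_set_fun_def comp_fun_def compose_def proj_fun_def)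
  qed
  then show "f = ?g"
    using Dom Cod by (intro set_fun.equality) auto
qed

end
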